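(* Let $(D,\sqsubseteq)$ be a finite partial ordering with least element $\bot$ and greatest element $\top$, and let $F$ be a finite set of inflationary and monotonic functions on $D$. Suppose the least common fixpoint $d_0$ of the functions in $F$ is computed by an execution of the RGI algorithm described in the context (with lists $\mathit{friends}(g,d)$, $\mathit{obviated}(g,d)$ satisfying condition ( * ) and $\mathit{update}$ satisfying (A), (B), (C)), and let $F_{\mathit{fin}}$ be the final value of the variable $F$ upon termination. Let $e\in D$ with $d_0\sqsubseteq e$. Then the least common fixpoint $\sqsupseteq e$ of the functions in $F$ coincides with the least common fixpoint $\sqsupseteq e$ of the functions in $F_{\mathit{fin}}$.
   Context: A function $f:D\to D$ is inflationary if $x\sqsubseteq f(x)$ for all $x$, and monotonic if $x\sqsubseteq y$ implies $f(x)\sqsubseteq f(y)$. RGI algorithm: $d:=\bot$; $F_0:=F$; $G:=F$; while $G\neq\emptyset$ and $d\neq\top$ do: choose $g\in G$; $G:=G-\{g\}$; $F:=F-(\mathit{friends}(g,d)\cup\mathit{obviated}(g,d))$; $G:=G-(\mathit{friends}(g,d)\cup\mathit{obviated}(g,d))$; $G:=G\cup\mathit{update}(G,h,d)$, where $\mathit{friends}(g,d)=[g_1,\ldots,g_k]$ and $h=g\circ g_1\circ\cdots\circ g_k$; $d:=h(d)$; end. Here for each $g\in F$, $d\in D$, $\mathit{friends}(g,d)$ and $\mathit{obviated}(g,d)$ are lists of functions from $F$ satisfying condition ( * ): for all $g\in F$, $d\in D$, with $\mathit{friends}(g,d)=[g_1,\ldots,g_k]$, every $f\in\mathit{friends}(g,d)\cup\mathit{obviated}(g,d)$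 satisfies $f(e)=e$ for all $e\sqsupseteq g\circ g_1\circ\cdots\circ g_k(d)$. And $\mathit{update}(G,h,d)$ is a subset of the current $F$ with: (A) $\{f\in F-G\mid f(d)=d\wedge f(h(d))\neq h(d)\}\subseteq\mathit{update}(G,h,d)$; (B) $h(d)=d$ implies $\mathit{update}(G,h,d)=\emptyset$; (C) $h(h(d))\neq h(d)$ implies $h\in\mathit{update}(G,h,d)$. *)

theory Defs
  imports Main
begin

definition inflationary :: "('a::order \<Rightarrow> 'a) \<Rightarrow> bool" where
  "inflationary f \<longleftrightarrow> (\<forall>x. x \<le> f x)"

definition common_fixpoint :: "('a \<Rightarrow> 'a) set \<Rightarrow> 'a \<Rightarrow> bool" where
  "common_fixpoint F x \<longleftrightarrow> (\<forall>f\<in>F. f x = x)"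

definition least_common_fixpoint :: "('a::order \<Rightarrow> 'a) set \<Rightarrow> 'a \<Rightarrow> bool" where
  "least_common_fixpoint F x \<longleftrightarrow>
     common_fixpoint F x \<and> (\<forall>y. common_fixpoint F y \<longrightarrow> x \<le> y)"

definition least_common_fixpoint_above :: "('a::order \<Rightarrow> 'a) set \<Rightarrow> 'a \<Rightarrow> 'a \<Rightarrow> bool" where
  "least_common_fixpoint_above F e x \<longleftrightarrow>
     common_fixpoint F x \<and> e \<le> x \<and> (\<forall>y. common_fixpoint F y \<and> e \<le> y \<longrightarrow> x \<le> y)"

type_synonym 'a fn_lists = "('a \<Rightarrow> 'a) \<Rightarrow> 'a \<Rightarrow> ('a \<Rightarrow> 'a) list"

text \<open>The composition $g \circ g_1 \circ \cdots \circ g_k$, where $[g_1, \ldots, g_k]$ is the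
  list of friends of $g$ at $d$.\<close>

definition with_friends :: "'a fn_lists \<Rightarrow> ('a \<Rightarrow> 'a) \<Rightarrow> 'a \<Rightarrow> ('a \<Rightarrow> 'a)" where
  "with_friends friends g d = g \<circ> foldr (\<circ>) (friends g d) id"

definition lists_from :: "('a \<Rightarrow> 'a) set \<Rightarrow> 'a fn_lists \<Rightarrow> bool" where
  "lists_from F l \<longleftrightarrow> (\<forall>g\<in>F. \<forall>d. set (l g d) \<subseteq> F)"

definition condition_star ::
    "('a::order \<Rightarrow> 'a) set \<Rightarrow> 'a fn_lists \<Rightarrow> 'a fn_lists \<Rightarrow> bool" where
  "condition_star F friends obviated \<longleftrightarrow>
     (\<forall>g\<in>F. \<forall>d. \<forall>f \<in> set (friends g d) \<union> set (obviated g d).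
        \<forall>e. with_friends friends g d d \<le> e \<longrightarrow> f e = e)"

text \<open>The requirements on \<open>U\<close>, the value of \<open>update\<close> at \<open>G\<close>, \<open>h\<close> and \<open>d\<close>, where \<open>F\<close> and \<open>G\<close>
  are the values of the program variables at the time \<open>update\<close> is called. The last three
  conjuncts are (A), (B) and (C).\<close>

definition update_conditions ::
    "('a \<Rightarrow> 'a) set \<Rightarrow> ('a \<Rightarrow> 'a) set \<Rightarrow> ('a \<Rightarrow> 'a) \<Rightarrow> 'a \<Rightarrow> ('a \<Rightarrow> 'a) set \<Rightarrow> bool" where
  "update_conditions F G h d U \<longleftrightarrow>
     U \<subseteq> F \<and>
     {f \<in> F - G. f d = d \<and> f (h d) \<noteq> h d} \<subseteq> U \<and>
     (h d = d \<longrightarrow> U = {}) \<and>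
     (h (h d) \<noteq> h d \<longrightarrow> h \<in> U)"

text \<open>A state \<open>(d, F, G)\<close> holds the current values of the three program variables;
  \<open>rgi_step\<close> is one execution of the loop body, including the loop guard. As the requirements on
  \<open>update\<close> refer to the current value of \<open>F\<close>, that value is an explicit first argument of
  \<open>update\<close>, and the requirements are imposed on the calls actually made.\<close>

inductive rgi_step ::
    "'a fn_lists \<Rightarrow> 'a fn_lists \<Rightarrow>
     (('a \<Rightarrow> 'a) set \<Rightarrow> ('a \<Rightarrow> 'a) set \<Rightarrow> ('a \<Rightarrow> 'a) \<Rightarrow> 'a \<Rightarrow> ('a \<Rightarrow> 'a) set) \<Rightarrow>
     'a::order_top \<times> ('a \<Rightarrow> 'a) set \<times> ('a \<Rightarrow> 'a) set \<Rightarrow>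
     'a \<times> ('a \<Rightarrow> 'a) set \<times> ('a \<Rightarrow> 'a) set \<Rightarrow> bool"
  for friends obviated update where
  "\<lbrakk> d \<noteq> top;
     g \<in> G;
     R = set (friends g d) \<union> set (obviated g d);
     F' = F - R;
     G' = (G - {g}) - R;
     h = with_friends friends g d;
     update_conditions F' G' h d (update F' G' h d) \<rbrakk>
   \<Longrightarrow> rgi_step friends obviated update (d, F, G) (h d, F', G' \<union> update F' G' h d)"

text \<open>\<open>rgi_computes friends obviated update F d F_fin\<close>: some execution started with the function
  set \<open>F\<close> terminates with \<open>d\<close> and \<open>F_fin\<close> as final values of the respective variables.\<close>

definition rgi_computes ::
    "'a fn_lists \<Rightarrow> 'a fn_lists \<Rightarrow>
     (('a \<Rightarrow> 'a) set \<Rightarrow> ('a \<Rightarrow> 'a) set \<Rightarrow> ('a \<Rightarrow> 'a) \<Rightarrow> 'a \<Rightarrow> ('a \<Rightarrow> 'a) set) \<Rightarrow>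
     ('a \<Rightarrow> 'a) set \<Rightarrow> 'a::{order_bot,order_top} \<Rightarrow> ('a \<Rightarrow> 'a) set \<Rightarrow> bool" where
  "rgi_computes friends obviated update F d F_fin \<longleftrightarrow>
     (\<exists>G. (rgi_step friends obviated update)\<^sup>*\<^sup>* (bot, F, F) (d, F_fin, G) \<and> (G = {} \<or> d = top))"

end

theory Submission
  imports Defs
begin

text \<open>By condition (*), a function discarded by the algorithm is the identity above the value that
  \<open>d\<close> takes in the same iteration. Since \<open>d\<close> only grows, every discarded function is the identity
  above \<open>d0\<close>. Hence \<open>F\<close> and \<open>F_fin\<close> have the same common fixpoints above \<open>e\<close>.\<close>

text \<open>The theorem also claims existence, which does not follow from the two sets having the
  same common fixpoints. Here the least one is obtained as a maximal element of the finite set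
  \<open>S\<close>.\<close>

lemma ex_least_common_fixpoint_above:
  fixes F :: "('a::{finite,order} \<Rightarrow> 'a) set"
  assumes "\<forall>f\<in>F. inflationary f \<and> mono f"
  shows "\<exists>x. least_common_fixpoint_above F e x"
proof -
  \<comment> \<open>Every maximal element of \<open>S\<close> is fixed by \<open>F\<close>, as \<open>S\<close> is closed under the functions in \<open>F\<close>.\<close>
  define S where "S = {x. e \<le> x \<and> (\<forall>y. common_fixpoint F y \<and> e \<le> y \<longrightarrow> x \<le> y)}"
  have "e \<in> S"
    by (simp add: S_def)
  then obtain x where x: "x \<in> S" and max: "\<And>y. y \<in> S \<Longrightarrow> x \<le> y \<Longrightarrow> x = y"
    using finite_has_maximal[OF finite[of S]] by blast
  have "f x = x" if "f \<in> F" for f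
  proof -
    have f: "inflationary f" "mono f"
      using assms that by auto
    have "x \<le> f x"
      using f by (simp add: inflationary_def)
    have "f x \<le> y" if y: "common_fixpoint F y" "e \<le> y" for y
    proof -
      have "f x \<le> f y"
        using x y f by (auto simp: S_def intro: monoD)
      also have "f y = y"
        using y \<open>f \<in> F\<close> by (simp add: common_fixpoint_def)
      finally show ?thesis .
    qed
    then have "f x \<in> S"
      using x \<open>x \<le> f x\<close> by (auto simp: S_def)
    then show ?thesis
      using max[of "f x"] \<open>x \<le> f x\<close> by simp
  qed
  then show ?thesis
    using x by (auto simp: S_def least_common_fixpoint_above_def common_fixpoint_def)
qed

lemma le_foldr_comp:
  fixes x :: "'a::order"
  assumes "\<forall>f\<in>set fs. inflationary f"
  shows "x \<le> foldr (\<circ>) fs id x"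
  using assms
proof (induction fs)
  case (Cons f fs)
  have "x \<le> foldr (\<circ>) fs id x"
    using Cons.prems by (intro Cons.IH) simp
  also have "\<dots> \<le> f (foldr (\<circ>) fs id x)"
    using Cons.prems by (simp add: inflationary_def)
  finally show ?case
    by (simp add: comp_def[abs_def] id_def)
qed simp

text \<open>Used with \<open>x = d\<close>, this makes \<open>d\<close> grow in each iteration.
  Friends of \<open>g\<close> lie in \<open>F\<close> by \<open>lists_from\<close>, so every factor
  of the composition is inflationary.\<close>

lemma le_with_friends:
  fixes x :: "'a::order"
  assumes "\<forall>f\<in>F. inflationary f" "lists_from F friends" "g \<in> F"
  shows "x \<le> with_friends friends g d x"
proof -
  have "x \<le> foldr (\<circ>) (friends g d) id x"
    using assms by (intro le_foldr_comp) (auto simp: lists_from_def)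
  also have "\<dots> \<le> g (foldr (\<circ>) (friends g d) id x)"
    using assms by (simp add: inflationary_def)
  finally show ?thesis
    by (simp add: with_friends_def)
qed

text \<open>The inclusions place each chosen \<open>g\<close> in the initial set
  \<open>F\<^sub>0\<close>, where the hypotheses on the lists apply. Quantifying over all
  \<open>e\<close> above \<open>d\<close>, and not only \<open>d\<close> itself, lets the last
  conjunct survive the growth of \<open>d\<close>.\<close>

definition rgi_invariant ::
    "('a \<Rightarrow> 'a) set \<Rightarrow> 'a::order \<times> ('a \<Rightarrow> 'a) set \<times> ('a \<Rightarrow> 'a) set \<Rightarrow> bool" where
  "rgi_invariant F\<^sub>0 = (\<lambda>(d, F, G).
     G \<subseteq> F \<and> F \<subseteq> F\<^sub>0 \<and> (\<forall>f \<in> F\<^sub>0 - F. \<forall>e. d \<le> e \<longrightarrow> f e = e))"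

lemma rgi_invariant_step:
  assumes "\<forall>f\<in>F\<^sub>0. inflationary f" "lists_from F\<^sub>0 friends" "condition_star F\<^sub>0 friends obviated"
    and "rgi_step friends obviated update s t" "rgi_invariant F\<^sub>0 s"
  shows "rgi_invariant F\<^sub>0 t"
  using assms(4)
proof cases
  case (1 d g G R F' F G' h)
  have "g \<in> F\<^sub>0" and inv: "G \<subseteq> F" "F \<subseteq> F\<^sub>0" "\<And>f e. \<lbrakk>f \<in> F\<^sub>0 - F; d \<le> e\<rbrakk> \<Longrightarrow> f e = e"
    using assms(5) 1 by (auto simp: rgi_invariant_def)
  have "d \<le> h d"
    using le_with_friends[OF assms(1,2) \<open>g \<in> F\<^sub>0\<close>] 1 by simp
  have "f e = e" if "f \<in> F\<^sub>0 - F'" "h d \<le> e" for f e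
  proof (cases "f \<in> F")
    case True
    then show ?thesis
      using that 1 assms(3) \<open>g \<in> F\<^sub>0\<close> unfolding condition_star_def by blast
  next
    case False
    then show ?thesis
      using that inv(3) \<open>d \<le> h d\<close> by (meson DiffD1 DiffI order_trans)
  qed
  \<comment> \<open>Functions put back into \<open>G\<close> have survived in \<open>F'\<close>, so
    \<open>G\<close> stays inside \<open>F\<close>.\<close>
  moreover have "update F' G' h d \<subseteq> F'"
    using 1 by (simp add: update_conditions_def)
  ultimately show ?thesis
    using 1 inv(1,2) by (auto simp: rgi_invariant_def)
qed

lemma rgi_invariant_steps:
  assumes "\<forall>f\<in>F\<^sub>0. inflationary f" "lists_from F\<^sub>0 friends" "condition_star F\<^sub>0 friends obviated"
    and "(rgi_step friends obviated update)\<^sup>*\<^sup>* s t" "rgi_invariant F\<^sub>0 s"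
  shows "rgi_invariant F\<^sub>0 t"
  using assms(4,5)
proof (induction rule: rtranclp_induct)
  case (step t u)
  then show ?case
    using rgi_invariant_step[OF assms(1-3)] by metis
qed

theorem theorem4:
  fixes F F_fin :: "('a::{finite,order_bot,order_top} \<Rightarrow> 'a) set"
    and friends obviated :: "'a fn_lists"
    and update :: "('a \<Rightarrow> 'a) set \<Rightarrow> ('a \<Rightarrow> 'a) set \<Rightarrow> ('a \<Rightarrow> 'a) \<Rightarrow> 'a \<Rightarrow> ('a \<Rightarrow> 'a) set"
    and d0 e :: 'a
  assumes "finite F"
    and "\<forall>f\<in>F. inflationary f \<and> mono f"
    and "lists_from F friends"
    and "lists_from F obviated"
    and "condition_star F friends obviated"
    and "least_common_fixpoint F d0"
    and "rgi_computes friends obviated update F d0 F_fin"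
    and "d0 \<le> e"
  shows "\<exists>x. least_common_fixpoint_above F e x \<and> least_common_fixpoint_above F_fin e x"
proof -
  obtain G where "(rgi_step friends obviated update)\<^sup>*\<^sup>* (bot, F, F) (d0, F_fin, G)"
    using assms(7) by (auto simp: rgi_computes_def)
  \<comment> \<open>The invariant holds initially since nothing has been discarded yet.\<close>
  from rgi_invariant_steps[OF _ assms(3,5) this] have "rgi_invariant F (d0, F_fin, G)"
    using assms(2) by (auto simp: rgi_invariant_def)
  then have inv: "F_fin \<subseteq> F" "\<And>f y. \<lbrakk>f \<in> F - F_fin; d0 \<le> y\<rbrakk> \<Longrightarrow> f y = y"
    by (auto simp: rgi_invariant_def)
  have "common_fixpoint F_fin y \<longleftrightarrow> common_fixpoint F y" if "e \<le> y" for y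
  proof -
    have "d0 \<le> y"
      using assms(8) that by (rule order_trans)
    then show ?thesis
      using inv unfolding common_fixpoint_def by blast
  qed
  \<comment> \<open>Only common fixpoints above \<open>e\<close> enter the definition, so agreement
    there suffices.\<close>
  then have "least_common_fixpoint_above F_fin e x \<longleftrightarrow> least_common_fixpoint_above F e x" for x
    unfolding least_common_fixpoint_above_def by blast
  then show ?thesis
    using ex_least_common_fixpoint_above[OF assms(2)] by simp
qed

end
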